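(* Let $M$ be a connected matroid, let $N$ be a binary matroid which is not a circuit (i.e., $E(N) \notin \mathcal{C}(N)$), and let $f: M \rightarrow N$ be a matroid homomorphism. Then $M$ is binary.
   Context: For a matroid $X$, $E(X)$ denotes its ground set and $\mathcal{C}(X)$ its set of circuits. A matroid homomorphism $f: M \rightarrow N$ is a map $f: E(M) \rightarrow E(N)$ from the ground set of $M$ onto the ground set of $N$ such that $f(C) \in \mathcal{C}(N)$ for every $C \in \mathcal{C}(M)$. *)

theory Defs
  imports Main "HOL-Library.Z2"
begin

locale matroid =
  fixes E :: "'a set" and indep :: "'a set \<Rightarrow> bool"
  assumes finite_ground: "finite E"
    and indep_subset_ground: "indep X \<Longrightarrow> X \<subseteq> E"
    and indep_empty: "indep {}"
    and indep_subset: "indep X \<Longrightarrow> Y \<subseteq> X \<Longrightarrow> indep Y"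
    and augment: "indep X \<Longrightarrow> indep Y \<Longrightarrow> card Y < card X \<Longrightarrow>
      \<exists>x \<in> X - Y. indep (insert x Y)"

definition circuits :: "'a set \<Rightarrow> ('a set \<Rightarrow> bool) \<Rightarrow> 'a set set" where
  "circuits E indep = {C. C \<subseteq> E \<and> \<not> indep C \<and> (\<forall>D. D \<subset> C \<longrightarrow> indep D)}"

definition connected_matroid :: "'a set \<Rightarrow> ('a set \<Rightarrow> bool) \<Rightarrow> bool" where
  "connected_matroid E indep \<longleftrightarrow>
    (\<forall>x \<in> E. \<forall>y \<in> E. x \<noteq> y \<longrightarrow> (\<exists>C \<in> circuits E indep. x \<in> C \<and> y \<in> C))"

text \<open>
  Linear independence over GF(2) of the family of columns with labels in \<open>X\<close> of the matrix
  \<open>A\<close> with rows \<open>0, \<dots>, r - 1\<close>; as a family, so that two equal columns with different labels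
  are dependent.
\<close>

definition columns_indep :: "nat \<Rightarrow> (nat \<Rightarrow> 'a \<Rightarrow> bit) \<Rightarrow> 'a set \<Rightarrow> bool" where
  "columns_indep r A X \<longleftrightarrow>
    (\<forall>c :: 'a \<Rightarrow> bit. (\<forall>i < r. (\<Sum>x \<in> X. c x * A i x) = 0) \<longrightarrow> (\<forall>x \<in> X. c x = 0))"

definition binary_matroid :: "'a set \<Rightarrow> ('a set \<Rightarrow> bool) \<Rightarrow> bool" where
  "binary_matroid E indep \<longleftrightarrow>
    (\<exists>r A. \<forall>X \<subseteq> E. indep X \<longleftrightarrow> columns_indep r A X)"

definition matroid_hom ::
  "('a \<Rightarrow> 'b) \<Rightarrow> 'a set \<Rightarrow> ('a set \<Rightarrow> bool) \<Rightarrow> 'b set \<Rightarrow> ('b set \<Rightarrow> bool) \<Rightarrow> bool" where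
  "matroid_hom f E indep E' indep' \<longleftrightarrow>
    f ` E = E' \<and> (\<forall>C \<in> circuits E indep. f ` C \<in> circuits E' indep')"

end

theory Submission
  imports Defs
begin

text \<open>
  Suppose that \<open>M\<close> is not binary. Then some set \<open>L\<close> of nullity two contains four circuits, any two
  of which cover \<open>L\<close>. If \<open>f(L)\<close> were not a circuit, the complements \<open>Q\<^sub>i\<close> of their images in \<open>f(L)\<close>
  would be disjoint and nonempty, and the sum \<open>Q\<^sub>1 \<union> Q\<^sub>2\<close> of two circuits would be a proper subset of
  a third circuit, which is impossible in the binary matroid \<open>N\<close>. So \<open>D = f(L)\<close> is a circuit, and
  every circuit inside \<open>L\<close> maps onto it.

  If \<open>f(e) \<notin> D\<close> for some \<open>e\<close>, connectedness gives an ear \<open>A \<ni> e\<close> of \<open>L\<close>, and at least three circuits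
  of \<open>L \<union> A\<close> contain \<open>A\<close>. Eliminating \<open>e\<close> from two of them leaves a circuit inside \<open>L\<close>, so their images
  together cover \<open>D\<close>. Hence the parts of \<open>D\<close> missed by the three images are disjoint and nonempty, while
  the union of two of them is a sum of two circuits of \<open>N\<close> inside \<open>D\<close> and therefore all of \<open>D\<close>: a
  contradiction. Thus \<open>E(N) = D\<close> is a circuit.
\<close>

section \<open>Cycles over GF(2)\<close>

text \<open>Elements of \<open>X \<inter> Y\<close> are counted twice on the right, which vanishes
  in characteristic two.\<close>

lemma sum_bit_sym_diff:
  fixes g :: "'a \<Rightarrow> bit"
  assumes "finite X" "finite Y"
  shows "(\<Sum>x \<in> (X - Y) \<union> (Y - X). g x) = (\<Sum>x\<in>X. g x) + (\<Sum>x\<in>Y. g x)"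
proof -
  have "(\<Sum>x\<in>X. g x) = (\<Sum>x\<in>X - Y. g x) + (\<Sum>x\<in>X \<inter> Y. g x)"
    using assms by (metis sum.Int_Diff add.commute)
  moreover have "(\<Sum>x\<in>Y. g x) = (\<Sum>x\<in>Y - X. g x) + (\<Sum>x\<in>X \<inter> Y. g x)"
    using assms by (metis sum.Int_Diff add.commute Int_commute)
  moreover have "(\<Sum>x \<in> (X - Y) \<union> (Y - X). g x) = (\<Sum>x\<in>X - Y. g x) + (\<Sum>x\<in>Y - X. g x)"
    using assms by (intro sum.union_disjoint) auto
  moreover have "(\<Sum>x\<in>X \<inter> Y. g x) + (\<Sum>x\<in>X \<inter> Y. g x) = 0"
    by simp
  ultimately show ?thesis
    by (metis (no_types, lifting) add.assoc add.commute add.right_neutral)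
qed

text \<open>Over GF(2) a coefficient vector is the indicator of its support, so linear dependences
  among columns can be handled as sets.\<close>

definition binary_cycle :: "nat \<Rightarrow> (nat \<Rightarrow> 'a \<Rightarrow> bit) \<Rightarrow> 'a set \<Rightarrow> bool" where
  "binary_cycle r A Z \<longleftrightarrow> (\<forall>i<r. (\<Sum>x\<in>Z. A i x) = 0)"

lemma binary_cycle_sym_diff:
  assumes "finite X" "finite Y" "binary_cycle r A X" "binary_cycle r A Y"
  shows "binary_cycle r A ((X - Y) \<union> (Y - X))"
  using assms by (simp add: binary_cycle_def sum_bit_sym_diff)

lemma columns_indep_iff_no_binary_cycle:
  assumes "finite X"
  shows "columns_indep r A X \<longleftrightarrow> (\<forall>Z\<subseteq>X. Z \<noteq> {} \<longrightarrow> \<not> binary_cycle r A Z)"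
proof
  assume ci: "columns_indep r A X"
  show "\<forall>Z\<subseteq>X. Z \<noteq> {} \<longrightarrow> \<not> binary_cycle r A Z"
  proof (intro allI impI notI)
    fix Z assume Z: "Z \<subseteq> X" "Z \<noteq> {}" "binary_cycle r A Z"
    let ?c = "\<lambda>x. if x \<in> Z then 1 else 0 :: bit"
    have "(\<Sum>x\<in>X. ?c x * A i x) = (\<Sum>x\<in>Z. A i x)" for i
      by (rule sum.mono_neutral_cong_right) (use assms Z in auto)
    then have "\<forall>x\<in>X. ?c x = 0"
      using ci[unfolded columns_indep_def, rule_format, of ?c] Z(3)
      unfolding binary_cycle_def by metis
    then show False using Z by (metis all_not_in_conv subsetD zero_neq_one)
  qed
next
  assume nc: "\<forall>Z\<subseteq>X. Z \<noteq> {} \<longrightarrow> \<not> binary_cycle r A Z"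
  show "columns_indep r A X"
    unfolding columns_indep_def
  proof (intro allI impI)
    fix c :: "'a \<Rightarrow> bit" assume c: "\<forall>i<r. (\<Sum>x\<in>X. c x * A i x) = 0"
    let ?Z = "{x \<in> X. c x \<noteq> 0}"
    have "(\<Sum>x\<in>X. c x * A i x) = (\<Sum>x\<in>?Z. A i x)" for i
      by (rule sum.mono_neutral_cong_right) (use assms in auto)
    then have "binary_cycle r A ?Z" using c by (simp add: binary_cycle_def)
    moreover have "?Z \<subseteq> X" by blast
    ultimately have "?Z = {}" using nc by metis
    then show "\<forall>x\<in>X. c x = 0" by blast
  qed
qed

section \<open>Circuits and their elimination\<close>

context matroid
begin

lemma indep_finite: "indep X \<Longrightarrow> finite X"
  using finite_ground finite_subset indep_subset_ground by blast

lemma circuit_subset_ground: "C \<in> circuits E indep \<Longrightarrow> C \<subseteq> E"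
  by (simp add: circuits_def)

lemma circuit_finite: "C \<in> circuits E indep \<Longrightarrow> finite C"
  using circuit_subset_ground finite_ground finite_subset by blast

lemma circuit_not_subset_indep: "C \<in> circuits E indep \<Longrightarrow> indep I \<Longrightarrow> \<not> C \<subseteq> I"
  using indep_subset by (auto simp: circuits_def)

lemma circuit_minus_indep: "C \<in> circuits E indep \<Longrightarrow> x \<in> C \<Longrightarrow> indep (C - {x})"
  by (auto simp: circuits_def)

lemma circuit_nonempty: "C \<in> circuits E indep \<Longrightarrow> C \<noteq> {}"
  using indep_empty by (auto simp: circuits_def)

lemma circuit_subset_eq:
  "C \<in> circuits E indep \<Longrightarrow> C' \<in> circuits E indep \<Longrightarrow> C \<subseteq> C' \<Longrightarrow> C = C'"
  by (auto simp: circuits_def)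

lemma dependent_contains_circuit:
  assumes "X \<subseteq> E" "\<not> indep X"
  obtains C where "C \<in> circuits E indep" "C \<subseteq> X"
proof -
  have "finite X" using assms finite_ground finite_subset by blast
  then have "\<exists>C\<in>circuits E indep. C \<subseteq> X" using assms
  proof (induction X rule: finite_psubset_induct)
    case (psubset X)
    show ?case
    proof (cases "\<forall>D. D \<subset> X \<longrightarrow> indep D")
      case True
      then show ?thesis using psubset.prems by (auto simp: circuits_def)
    next
      case False
      then obtain D where D: "D \<subset> X" "\<not> indep D" by blast
      then have "\<exists>C\<in>circuits E indep. C \<subseteq> D" using psubset by blast
      then show ?thesis using D by blast
    qed
  qed
  then show ?thesis using that by blast
qed

lemma extend_to_maximal_indep:
  assumes "indep I" "I \<subseteq> S" "S \<subseteq> E"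
  obtains J where "I \<subseteq> J" "J \<subseteq> S" "indep J" "\<And>x. x \<in> S - J \<Longrightarrow> \<not> indep (insert x J)"
proof -
  let ?F = "{J. I \<subseteq> J \<and> J \<subseteq> S \<and> indep J}"
  have "finite ?F"
    by (rule finite_subset[of _ "Pow E"]) (use assms finite_ground in auto)
  moreover have "?F \<noteq> {}" using assms by blast
  ultimately have "\<exists>J\<in>?F. \<forall>K\<in>?F. J \<subseteq> K \<longrightarrow> J = K" by (rule finite_has_maximal)
  then obtain J where J: "J \<in> ?F" and max: "\<forall>K\<in>?F. J \<subseteq> K \<longrightarrow> J = K" by (elim bexE)
  have "\<not> indep (insert x J)" if "x \<in> S - J" for x
    using that J bspec[OF max, of "insert x J"] by blast
  then show ?thesis using that J by blast
qed

text \<open>A rank argument: \<open>C2\<close> puts \<open>e\<close> in the span of the remaining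
  elements, and \<open>C1\<close> puts \<open>h\<close> in the span once \<open>e\<close> is
  present. So \<open>h\<close> depends on a maximal independent set \<open>I\<close> that avoids
  \<open>e\<close>, and the resulting circuit must use \<open>h\<close>.\<close>

lemma strong_circuit_elimination:
  assumes C1: "C1 \<in> circuits E indep" and C2: "C2 \<in> circuits E indep"
    and e: "e \<in> C1 \<inter> C2" and h: "h \<in> C1 - C2"
  obtains C where "C \<in> circuits E indep" "C \<subseteq> C1 \<union> C2 - {e}" "h \<in> C"
proof -
  let ?S = "C1 \<union> C2 - {e, h}"
  have SE: "insert e ?S \<subseteq> E" "?S \<subseteq> E"
    using C1 C2 e circuit_subset_ground by blast+
  obtain I where I: "C2 - {e} \<subseteq> I" "I \<subseteq> ?S" "indep I"
      "\<And>x. x \<in> ?S - I \<Longrightarrow> \<not> indep (insert x I)"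
    using extend_to_maximal_indep[of "C2 - {e}" ?S] circuit_minus_indep[OF C2] e h SE by blast
  obtain J where J: "C1 - {h} \<subseteq> J" "J \<subseteq> insert e ?S" "indep J"
      "\<And>x. x \<in> insert e ?S - J \<Longrightarrow> \<not> indep (insert x J)"
    using extend_to_maximal_indep[of "C1 - {h}" "insert e ?S"] circuit_minus_indep[OF C1] h SE
    by blast
  have Imax: "\<not> indep (insert x I)" if "x \<in> insert e ?S - I" for x
  proof (cases "x = e")
    case True
    then show ?thesis using I(1) circuit_not_subset_indep[OF C2] by blast
  next
    case False
    then show ?thesis using that I(4) by blast
  qed
  have "card J \<le> card I"
  proof (rule ccontr)
    assume "\<not> card J \<le> card I"
    then obtain x where "x \<in> J - I" "indep (insert x I)"
      using augment[OF J(3) I(3)] by auto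
    then show False using Imax J(2) by blast
  qed
  have hI: "h \<notin> I" using I(2) by blast
  have "\<not> indep (insert h I)"
  proof
    assume a: "indep (insert h I)"
    have "card J < card (insert h I)"
      using \<open>card J \<le> card I\<close> hI indep_finite[OF I(3)] by simp
    then obtain x where x: "x \<in> insert h I - J" "indep (insert x J)"
      using augment[OF a J(3)] by blast
    show False
    proof (cases "x = h")
      case True
      then show False using x J(1) circuit_not_subset_indep[OF C1, of "insert h J"] by blast
    next
      case False
      then show False using x I(2) J(4) by blast
    qed
  qed
  moreover have "insert h I \<subseteq> E" using I(2) SE C1 h circuit_subset_ground by blast
  ultimately obtain C where C: "C \<in> circuits E indep" "C \<subseteq> insert h I"
    using dependent_contains_circuit by blast
  moreover have "h \<in> C" using C circuit_not_subset_indep[OF _ I(3)] by blast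
  moreover have "C \<subseteq> C1 \<union> C2 - {e}" using C(2) I(2) e h by blast
  ultimately show ?thesis using that by blast
qed

lemma circuit_elimination:
  assumes "C1 \<in> circuits E indep" "C2 \<in> circuits E indep" "C1 \<noteq> C2" "e \<in> C1 \<inter> C2"
  obtains C where "C \<in> circuits E indep" "C \<subseteq> C1 \<union> C2 - {e}"
proof -
  obtain h where "h \<in> C1 - C2" using assms circuit_subset_eq by blast
  then show ?thesis using strong_circuit_elimination[OF assms(1,2,4)] that by blast
qed

lemma unique_circuit_insert:
  assumes "indep I" "C \<in> circuits E indep" "C' \<in> circuits E indep"
    and "C \<subseteq> insert e I" "C' \<subseteq> insert e I"
  shows "C = C'"
proof (rule ccontr)
  assume "C \<noteq> C'"
  moreover have "e \<in> C \<inter> C'" using assms circuit_not_subset_indep by blast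
  ultimately obtain D where "D \<in> circuits E indep" "D \<subseteq> C \<union> C' - {e}"
    using circuit_elimination assms by metis
  then show False using assms circuit_not_subset_indep[of D I] by blast
qed

section \<open>Bases and fundamental circuits\<close>

definition base :: "'a set \<Rightarrow> bool" where
  "base B \<longleftrightarrow> indep B \<and> (\<forall>x\<in>E - B. \<not> indep (insert x B))"

lemma indep_extends_to_base:
  assumes "indep I"
  obtains B where "base B" "I \<subseteq> B"
  using extend_to_maximal_indep[OF assms indep_subset_ground[OF assms] order.refl]
  unfolding base_def by metis

lemma indep_card_le_base:
  assumes "indep I" "base B"
  shows "card I \<le> card B"
proof (rule ccontr)
  assume "\<not> ?thesis"
  then obtain x where "x \<in> I - B" "indep (insert x B)"
    using augment[of I B] assms by (auto simp: base_def)
  then show False using assms indep_subset_ground[of I] by (auto simp: base_def)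
qed

lemma base_card_eq: "base B \<Longrightarrow> base B' \<Longrightarrow> card B = card B'"
  by (simp add: antisym base_def indep_card_le_base)

lemma base_if_card_eq:
  assumes "indep I" "base B" "card I = card B"
  shows "base I"
  unfolding base_def
proof (intro conjI ballI notI)
  fix x assume "x \<in> E - I" "indep (insert x I)"
  then show False
    using indep_card_le_base[of "insert x I" B] assms indep_finite[of I] by simp
qed (rule assms)

lemma fundamental_circuit:
  assumes "base B" "e \<in> E - B"
  obtains C where "C \<in> circuits E indep" "C \<subseteq> insert e B" "e \<in> C"
proof -
  have "insert e B \<subseteq> E" "\<not> indep (insert e B)"
    using assms indep_subset_ground by (auto simp: base_def)
  then obtain C where "C \<in> circuits E indep" "C \<subseteq> insert e B"
    using dependent_contains_circuit by blast
  moreover from this have "e \<in> C"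
    using assms(1) circuit_not_subset_indep[of C B] by (auto simp: base_def)
  ultimately show ?thesis using that by blast
qed

text \<open>\<open>C\<close> is the only circuit in \<open>insert e B\<close>, so deleting any
  \<open>x\<close> of it leaves an independent set of the right size.\<close>

lemma base_exchange:
  assumes B: "base B" and e: "e \<in> E - B" and C: "C \<in> circuits E indep" "C \<subseteq> insert e B"
    and x: "x \<in> C" "x \<noteq> e"
  shows "base (insert e (B - {x}))"
proof (rule base_if_card_eq[OF _ B])
  have iB: "indep B" and fB: "finite B" using B indep_finite by (auto simp: base_def)
  have xB: "x \<in> B" using C x by blast
  have "insert e (B - {x}) \<subseteq> E" using e iB indep_subset_ground by blast
  show "indep (insert e (B - {x}))"
  proof (rule ccontr)
    assume "\<not> ?thesis"
    then obtain D where D: "D \<in> circuits E indep" "D \<subseteq> insert e (B - {x})"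
      using dependent_contains_circuit \<open>insert e (B - {x}) \<subseteq> E\<close> by metis
    then have "D = C" using unique_circuit_insert[OF iB, of D C e] C by blast
    then show False using D x by blast
  qed
  show "card (insert e (B - {x})) = card B"
    using e fB card_Suc_Diff1[OF fB xB] by (subst card_insert_disjoint) auto
qed

text \<open>Any base is reached from \<open>B0\<close> by single exchanges. Augmentation swaps an
  element of \<open>B - B0\<close> for one of \<open>B0\<close>, which gives a base closer to
  \<open>B0\<close>.\<close>

lemma base_exchange_induct:
  assumes B0: "base B0" and P0: "P B0"
    and step: "\<And>B C e x. base B \<Longrightarrow> P B \<Longrightarrow> e \<in> E - B \<Longrightarrow> C \<in> circuits E indep \<Longrightarrow>
      C \<subseteq> insert e B \<Longrightarrow> x \<in> C \<Longrightarrow> x \<noteq> e \<Longrightarrow> P (insert e (B - {x}))"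
    and B: "base B"
  shows "P B"
  using B
proof (induction "card (B - B0)" arbitrary: B rule: less_induct)
  case less
  have iB: "indep B" "finite B" using less.prems indep_finite by (auto simp: base_def)
  have iB0: "indep B0" "finite B0" using B0 indep_finite by (auto simp: base_def)
  show ?case
  proof (cases "B \<subseteq> B0")
    case True
    then have "B = B0"
      using base_card_eq[OF less.prems B0] iB0 by (simp add: card_subset_eq)
    then show ?thesis using P0 by simp
  next
    case False
    then obtain x where x: "x \<in> B" "x \<notin> B0" by blast
    have "card (B - {x}) < card B0"
      using base_card_eq[OF less.prems B0] card_Diff1_less[OF iB(2) x(1)] by simp
    then obtain e where e: "e \<in> B0 - (B - {x})" "indep (insert e (B - {x}))"
      using augment[OF iB0(1) indep_subset[OF iB(1), of "B - {x}"]] by blast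
    let ?B = "insert e (B - {x})"
    have ex: "e \<noteq> x" "e \<notin> B" using e x by auto
    have "card ?B = card B"
      using ex iB(2) card_Suc_Diff1[OF iB(2) x(1)] by (subst card_insert_disjoint) auto
    then have bB: "base ?B" using base_if_card_eq[OF e(2) less.prems] by simp
    have "?B - B0 \<subseteq> B - B0 - {x}" using e(1) by auto
    then have "?B - B0 \<subset> B - B0" using x by blast
    then have "card (?B - B0) < card (B - B0)" using iB by (simp add: psubset_card_mono)
    then have P: "P ?B" using less.hyps bB by blast
    \<comment> \<open>The hypothesis \<open>step\<close> runs the exchange backwards: from the
      closer base \<open>?B\<close>, \<open>x\<close> enters again and \<open>e\<close>
      leaves.\<close>
    have xE: "x \<in> E - ?B" using x ex iB indep_subset_ground by blast
    obtain C where C: "C \<in> circuits E indep" "C \<subseteq> insert x ?B" "x \<in> C"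
      using fundamental_circuit[OF bB xE] by blast
    have "e \<in> C" using C x circuit_not_subset_indep[OF C(1) iB(1)] by blast
    then have "P (insert x (?B - {e}))" using step[OF bB P xE C(1,2)] ex by blast
    moreover have "insert x (?B - {e}) = B" using x ex by blast
    ultimately show ?thesis by simp
  qed
qed

section \<open>A criterion for being binary\<close>

text \<open>
  The matrix is the fundamental-circuit matrix of a fixed base \<open>B0\<close>. The hypothesis makes the
  property that all fundamental circuits are cycles of the matrix, while no nonempty subset of the
  base is one, pass from a base to its neighbours; and every circuit is fundamental for some base.
\<close>

lemma binary_matroid_if_modular_sym_diff:
  assumes modular: "\<And>B e g x C1 C2 C3. base B \<Longrightarrow> e \<in> E - B \<Longrightarrow> g \<in> E - B \<Longrightarrow> e \<noteq> g \<Longrightarrow>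
      C1 \<in> circuits E indep \<Longrightarrow> C2 \<in> circuits E indep \<Longrightarrow> C3 \<in> circuits E indep \<Longrightarrow>
      C1 \<subseteq> insert e B \<Longrightarrow> C2 \<subseteq> insert g B \<Longrightarrow> x \<in> C1 \<inter> C2 \<Longrightarrow> C3 \<subseteq> C1 \<union> C2 - {x} \<Longrightarrow>
      C3 = (C1 - C2) \<union> (C2 - C1)"
  shows "binary_matroid E indep"
proof -
  obtain B0 where B0: "base B0" using indep_extends_to_base[OF indep_empty] by blast
  have iB0: "indep B0" "finite B0" using B0 indep_finite by (auto simp: base_def)
  obtain b :: "nat \<Rightarrow> 'a" where b: "bij_betw b {..<card B0} B0"
    using ex_bij_betw_nat_finite[OF iB0(2)] by (auto simp: atLeast0LessThan)
  \<comment> \<open>Row \<open>i\<close> belongs to the base element \<open>b i\<close>. The columns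
    of \<open>B0\<close> form an identity matrix; any other column marks the base elements in the
    fundamental circuit of its label.\<close>
  define A :: "nat \<Rightarrow> 'a \<Rightarrow> bit" where
    "A i x = (if x \<in> B0 then (if x = b i then 1 else 0)
      else if (\<exists>C\<in>circuits E indep. C \<subseteq> insert x B0 \<and> b i \<in> C) then 1 else 0)" for i x
  let ?Z = "binary_cycle (card B0) A"
  define P where "P B \<longleftrightarrow> (\<forall>C\<in>circuits E indep. \<forall>e. C \<subseteq> insert e B \<longrightarrow> ?Z C) \<and>
    (\<forall>Z\<subseteq>B. Z \<noteq> {} \<longrightarrow> \<not> ?Z Z)" for B
  have P0: "P B0"
    unfolding P_def
  proof (intro conjI allI ballI impI)
    fix C e assume C: "C \<in> circuits E indep" "C \<subseteq> insert e B0"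
    have eC: "e \<in> C" "e \<notin> B0" using C circuit_not_subset_indep iB0 by (metis insert_absorb subset_insert)+
    show "?Z C"
      unfolding binary_cycle_def
    proof (intro allI impI)
      fix i assume i: "i < card B0"
      then have bi: "b i \<in> B0" using b by (auto simp: bij_betw_def)
      have fC: "finite (C - {e})" using C circuit_finite by blast
      have "(\<Sum>x\<in>C - {e}. A i x) = (\<Sum>x\<in>C - {e}. if x = b i then 1 else 0)"
        by (rule sum.cong) (use C in \<open>auto simp: A_def\<close>)
      also have "\<dots> = (if b i \<in> C then 1 else 0)"
        using fC bi eC by (auto simp: sum.delta)
      finally have *: "(\<Sum>x\<in>C - {e}. A i x) = (if b i \<in> C then 1 else 0)" .
      \<comment> \<open>By uniqueness of the fundamental circuit, column \<open>e\<close> is the sum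
        of the other columns of \<open>C\<close>.\<close>
      have "(\<exists>D\<in>circuits E indep. D \<subseteq> insert e B0 \<and> b i \<in> D) \<longleftrightarrow> b i \<in> C"
        using C unique_circuit_insert[OF iB0(1)] by blast
      then have "A i e = (if b i \<in> C then 1 else 0)" using eC by (simp add: A_def)
      then show "(\<Sum>x\<in>C. A i x) = 0"
        using * sum.remove[OF circuit_finite[OF C(1)] eC(1), of "A i"] by simp
    qed
  next
    fix Z assume Z: "Z \<subseteq> B0" "Z \<noteq> {}"
    then obtain z where z: "z \<in> Z" by blast
    then have "z \<in> b ` {..<card B0}" using Z bij_betw_imp_surj_on[OF b] by blast
    then obtain i where i: "i < card B0" "b i = z" by blast
    have "finite Z" using Z iB0 finite_subset by blast
    have "(\<Sum>x\<in>Z. A i x) = (\<Sum>x\<in>Z. if x = z then 1 else 0)"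
      by (rule sum.cong) (use Z i in \<open>auto simp: A_def\<close>)
    also have "\<dots> = 1" using z \<open>finite Z\<close> by (simp add: sum.delta)
    finally show "\<not> ?Z Z" using i by (auto simp: binary_cycle_def)
  qed
  have step: "P (insert e (B - {x}))"
    if B: "base B" "P B" and e: "e \<in> E - B" and C: "C \<in> circuits E indep" "C \<subseteq> insert e B"
      and x: "x \<in> C" "x \<noteq> e" for B C e x
    unfolding P_def
  proof (intro conjI allI ballI impI)
    let ?B = "insert e (B - {x})"
    have iB: "indep B" using B by (simp add: base_def)
    have iB': "indep ?B" using base_exchange[OF B(1) e C x] by (simp add: base_def)
    have eC: "e \<in> C" using C circuit_not_subset_indep[OF _ iB] by blast
    have ZC: "?Z C" using B(2) C unfolding P_def by blast
    {
      fix D g assume D: "D \<in> circuits E indep" "D \<subseteq> insert g ?B"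
      have gD: "g \<in> D" "g \<notin> ?B" using D circuit_not_subset_indep[OF D(1) iB'] by blast+
      show "?Z D"
      proof (cases "g = x")
        case True
        then have "D = C" using unique_circuit_insert[OF iB, of D C e] D C x by blast
        then show ?thesis using ZC by simp
      next
        case False
        then have gE: "g \<in> E - B" "e \<noteq> g" using gD D circuit_subset_ground by blast+
        obtain D' where D': "D' \<in> circuits E indep" "D' \<subseteq> insert g B" "g \<in> D'"
          using fundamental_circuit[OF B(1) gE(1)] by blast
        have ZD': "?Z D'" using B(2) D' unfolding P_def by blast
        show ?thesis
        proof (cases "x \<in> D'")
          case True
          \<comment> \<open>A pivot: eliminating \<open>x\<close> from \<open>C\<close> and
            \<open>D'\<close> gives the new fundamental circuit of \<open>g\<close>, and
            \<open>modular\<close> identifies it with the sum of two cycles.\<close>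
          have "C \<noteq> D'" using eC D' e gE by blast
          then obtain C3 where C3: "C3 \<in> circuits E indep" "C3 \<subseteq> C \<union> D' - {x}"
            using circuit_elimination[of C D' x] C D' x True by blast
          then have "C3 = (C - D') \<union> (D' - C)"
            using modular[OF B(1) e gE C(1) D'(1) C3(1) C(2) D'(2)] x True by blast
          moreover have "C3 \<subseteq> insert g ?B" using C3 C D' by blast
          then have "D = C3" using unique_circuit_insert[OF iB' D(1) C3(1) D(2)] by blast
          ultimately show ?thesis
            using binary_cycle_sym_diff[OF circuit_finite[OF C(1)] circuit_finite[OF D'(1)] ZC ZD']
            by simp
        next
          case False
          then have "D' \<subseteq> insert g ?B" using D' by blast
          then have "D = D'" using unique_circuit_insert[OF iB' D(1) D'(1) D(2)] by blast
          then show ?thesis using ZD' by simp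
        qed
      qed
    next
      fix Z assume Z: "Z \<subseteq> ?B" "Z \<noteq> {}"
      have fZ: "finite Z" using Z indep_finite[OF iB'] finite_subset by blast
      show "\<not> ?Z Z"
      proof (cases "e \<in> Z")
        case True
        \<comment> \<open>Adding \<open>C\<close> cancels \<open>e\<close> and brings in
          \<open>x\<close>, so a cycle \<open>Z\<close> would yield a nonempty cycle inside the old
          base.\<close>
        let ?W = "(Z - C) \<union> (C - Z)"
        have "?W \<subseteq> B" using Z C True eC by blast
        moreover have "x \<in> ?W" using x Z by blast
        ultimately have "\<not> ?Z ?W" using B(2) unfolding P_def by blast
        then show ?thesis
          using binary_cycle_sym_diff[OF fZ circuit_finite[OF C(1)] _ ZC] by blast
      next
        case False
        then have "Z \<subseteq> B" using Z by blast
        then show ?thesis using B(2) Z unfolding P_def by blast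
      qed
    }
  qed
  have P: "P B" if "base B" for B
    by (rule base_exchange_induct[where P = P, OF B0 P0 step that])
  have "indep X \<longleftrightarrow> columns_indep (card B0) A X" if X: "X \<subseteq> E" for X
  proof -
    have fX: "finite X" using X finite_ground finite_subset by blast
    show ?thesis
      unfolding columns_indep_iff_no_binary_cycle[OF fX]
    proof
      assume "indep X"
      then obtain B where "base B" "X \<subseteq> B" using indep_extends_to_base by blast
      then show "\<forall>Z\<subseteq>X. Z \<noteq> {} \<longrightarrow> \<not> ?Z Z" using P unfolding P_def by blast
    next
      assume nc: "\<forall>Z\<subseteq>X. Z \<noteq> {} \<longrightarrow> \<not> ?Z Z"
      show "indep X"
      proof (rule ccontr)
        assume "\<not> indep X"
        then obtain C where C: "C \<in> circuits E indep" "C \<subseteq> X"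
          using dependent_contains_circuit X by blast
        \<comment> \<open>Any circuit is fundamental for a base extending it minus one element, so
          it is a cycle.\<close>
        obtain e where e: "e \<in> C" using circuit_nonempty[OF C(1)] by blast
        obtain B where B: "base B" "C - {e} \<subseteq> B"
          using indep_extends_to_base[OF circuit_minus_indep[OF C(1) e]] by blast
        then have "?Z C" using P[OF B(1)] C(1) unfolding P_def by blast
        then show False using nc C circuit_nonempty by blast
      qed
    qed
  qed
  then show ?thesis unfolding binary_matroid_def by blast
qed

section \<open>Four circuits in a set of nullity two\<close>

text \<open>In dual terms, the conclusion says that the matroid has a \<open>U\<^sub>2\<^sub>,\<^sub>4\<close> minor: the dual of the
  restriction to \<open>L\<close> has rank two, and the sets \<open>L - C\<^sub>i\<close> are four of its parallel classes.\<close>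

lemma not_binary_four_circuits:
  assumes "\<not> binary_matroid E indep"
  obtains C1 C2 C3 C4 L where
    "{C1, C2, C3, C4} \<subseteq> circuits E indep" "distinct [C1, C2, C3, C4]" "C1 \<union> C2 = L" "C3 \<union> C4 \<subseteq> L"
    "\<forall>C\<in>circuits E indep. \<forall>C'\<in>circuits E indep. C \<subseteq> L \<longrightarrow> C' \<subseteq> L \<longrightarrow> C \<noteq> C' \<longrightarrow> C \<union> C' = L"
proof -
  obtain B e g x C1 C2 C3 where B: "base B" and eg: "e \<in> E - B" "g \<in> E - B" "e \<noteq> g"
    and C: "C1 \<in> circuits E indep" "C2 \<in> circuits E indep" "C3 \<in> circuits E indep"
    and C1: "C1 \<subseteq> insert e B" and C2: "C2 \<subseteq> insert g B" and x: "x \<in> C1 \<inter> C2"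
    and C3: "C3 \<subseteq> C1 \<union> C2 - {x}" and ne: "C3 \<noteq> (C1 - C2) \<union> (C2 - C1)"
    using assms binary_matroid_if_modular_sym_diff by metis
  let ?L = "C1 \<union> C2"
  have iB: "indep B" using B by (simp add: base_def)
  have eC1: "e \<in> C1" and gC2: "g \<in> C2" using C C1 C2 circuit_not_subset_indep[OF _ iB] by blast+
  have indep_del: "indep (insert a B - {y})"
    if "a \<in> E - B" "D \<in> circuits E indep" "D \<subseteq> insert a B" "y \<in> D" for a D y
  proof (cases "y = a")
    case True
    then show ?thesis using iB indep_subset by (metis Diff_insert_absorb Diff_iff that(1))
  next
    case False
    then have "base (insert a (B - {y}))" using base_exchange[OF B that(1-3) that(4)] by blast
    moreover have "insert a (B - {y}) = insert a B - {y}" using False by blast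
    ultimately show ?thesis by (simp add: base_def)
  qed
  \<comment> \<open>If both circuits missed some \<open>y\<close>, they would lie in an independent
    set plus one element, which holds only one circuit. The independent set is
    \<open>insert e B - {y}\<close> when \<open>y\<close> is in \<open>C1\<close>, and
    \<open>insert g B - {y}\<close> otherwise.\<close>
  have nullity: "D \<union> D' = ?L"
    if D: "D \<in> circuits E indep" "D' \<in> circuits E indep" "D \<subseteq> ?L" "D' \<subseteq> ?L" "D \<noteq> D'" for D D'
  proof (rule ccontr)
    assume "D \<union> D' \<noteq> ?L"
    then obtain y where y: "y \<in> ?L" "y \<notin> D" "y \<notin> D'" using D by blast
    show False
    proof (cases "y \<in> C1")
      case True
      have "D \<subseteq> insert g (insert e B - {y})" "D' \<subseteq> insert g (insert e B - {y})"
        using D y C1 C2 by blast+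
      then show False
        using unique_circuit_insert[OF indep_del[OF eg(1) C(1) C1 True] D(1,2)] D(5) by blast
    next
      case False
      then have y2: "y \<in> C2" using y by blast
      have "D \<subseteq> insert e (insert g B - {y})" "D' \<subseteq> insert e (insert g B - {y})"
        using D y C1 C2 by blast+
      then show False
        using unique_circuit_insert[OF indep_del[OF eg(2) C(2) C2 y2] D(1,2)] D(5) by blast
    qed
  qed
  have ne12: "C1 \<noteq> C2" using eC1 C2 eg by blast
  have ne3: "C3 \<noteq> C1" "C3 \<noteq> C2" using x C3 by blast+
  have "C3 \<union> C1 = ?L" "C3 \<union> C2 = ?L" using nullity C C3 ne3 by blast+
  \<comment> \<open>Covering \<open>?L\<close> with \<open>C1\<close> and with \<open>C2\<close>
    forces \<open>C3\<close> to contain their symmetric difference; not being equal to it,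
    \<open>C3\<close> has a point in \<open>C1 \<inter> C2\<close>. Eliminating that point yields a
    fourth circuit.\<close>
  then obtain w where w: "w \<in> C1 \<inter> C2" "w \<in> C3" using ne C3 by blast
  obtain C4 where C4: "C4 \<in> circuits E indep" "C4 \<subseteq> C1 \<union> C2 - {w}"
    using circuit_elimination[OF C(1,2) ne12 w(1)] by blast
  have ne4: "C4 \<noteq> C1" "C4 \<noteq> C2" "C4 \<noteq> C3" using w C4 by blast+
  show ?thesis
  proof (rule that[of C1 C2 C3 C4 ?L])
    show "{C1, C2, C3, C4} \<subseteq> circuits E indep" using C C4 by blast
    show "distinct [C1, C2, C3, C4]" using ne12 ne3 ne4 by auto
    show "C3 \<union> C4 \<subseteq> ?L" using C3 C4 by blast
  qed (use nullity in \<open>blast+\<close>)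
qed

section \<open>Ears of a connected matroid\<close>

text \<open>The last conclusion says that \<open>C - L\<close> is a circuit of the contraction by \<open>L\<close>.\<close>

lemma connected_ear:
  assumes con: "connected_matroid E indep" and L: "L \<subseteq> E" "L \<noteq> {}" and e: "e \<in> E - L"
  obtains C where "C \<in> circuits E indep" "e \<in> C" "C \<inter> L \<noteq> {}"
    "\<forall>D\<in>circuits E indep. D \<subseteq> L \<union> C \<longrightarrow> D \<subseteq> L \<or> C - L \<subseteq> D"
proof -
  let ?Q = "\<lambda>C. C \<in> circuits E indep \<and> e \<in> C \<and> C \<inter> L \<noteq> {}"
  obtain p where "p \<in> L" using L by blast
  moreover from this have "p \<in> E" "p \<noteq> e" using L e by blast+
  ultimately obtain C0 where "?Q C0" using con e unfolding connected_matroid_def by blast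
  \<comment> \<open>The ear is a circuit through \<open>e\<close> meeting \<open>L\<close> with as
    few elements outside \<open>L\<close> as possible.\<close>
  then obtain C where QC: "?Q C" and min: "\<And>D. ?Q D \<Longrightarrow> card (C - L) \<le> card (D - L)"
    using exists_least_iff[of "\<lambda>n. \<exists>C. ?Q C \<and> card (C - L) = n"] by (metis not_le)
  have minimal: "\<not> D - L \<subset> C - L" if "?Q D" for D
    using min[OF that] psubset_card_mono[of "C - L" "D - L"] circuit_finite QC
    by (metis finite_Diff not_le)
  have "D \<subseteq> L \<or> C - L \<subseteq> D" if D: "D \<in> circuits E indep" "D \<subseteq> L \<union> C" for D
  proof (rule ccontr)
    assume a: "\<not> ?thesis"
    then obtain a where a': "a \<in> D" "a \<notin> L" "a \<in> C" using D by blast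
    have psub: "D - L \<subset> C - L" using D a by blast
    have "D \<inter> L \<noteq> {}"
    proof
      assume "D \<inter> L = {}"
      then have "D \<subseteq> C" using D by blast
      then have "D = C" using circuit_subset_eq D QC by blast
      then show False using a by blast
    qed
    then have "e \<notin> D" using minimal psub D by blast
    \<comment> \<open>Removing \<open>a\<close> while keeping \<open>e\<close> makes the part
      outside \<open>L\<close> smaller. By minimality \<open>C'\<close> misses \<open>L\<close>, and
      then it lies properly inside \<open>C\<close>.\<close>
    then obtain C' where C': "C' \<in> circuits E indep" "C' \<subseteq> C \<union> D - {a}" "e \<in> C'"
      using strong_circuit_elimination[of C D a e] QC D a' by blast
    have "C' - L \<subset> C - L" using C' a' D by blast
    then have "C' \<inter> L = {}" using minimal C' by blast
    then have "C' \<subset> C" using C' D a' by blast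
    then show False using circuit_subset_eq C' QC by blast
  qed
  then have "\<forall>D\<in>circuits E indep. D \<subseteq> L \<union> C \<longrightarrow> D \<subseteq> L \<or> C - L \<subseteq> D" by blast
  then show ?thesis using that[of C] QC by simp
qed

text \<open>If \<open>C\<close> and some \<open>B\<close> were the only circuits running through the ear, elimination would force
  every circuit of \<open>L\<close> meeting \<open>C\<close> to equal \<open>(C \<union> B) \<inter> L\<close>.\<close>

lemma three_circuits_through_ear:
  assumes C: "C \<in> circuits E indep" "e \<in> C" "e \<notin> L" "C \<inter> L \<noteq> {}"
    and ear: "\<forall>D\<in>circuits E indep. D \<subseteq> L \<union> C \<longrightarrow> D \<subseteq> L \<or> C - L \<subseteq> D"
    and two: "\<And>p. p \<in> L \<Longrightarrow> \<exists>D\<in>circuits E indep. \<exists>D'\<in>circuits E indep.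
      D \<noteq> D' \<and> p \<in> D \<and> p \<in> D' \<and> D \<subseteq> L \<and> D' \<subseteq> L"
  obtains B1 B2 B3 where "{B1, B2, B3} \<subseteq> circuits E indep" "distinct [B1, B2, B3]"
    "\<forall>B\<in>{B1, B2, B3}. B \<subseteq> L \<union> C \<and> C - L \<subseteq> B"
proof -
  let ?T = "{B \<in> circuits E indep. B \<subseteq> L \<union> C \<and> C - L \<subseteq> B}"
  \<comment> \<open>Strong elimination keeps \<open>e\<close>, which is outside \<open>L\<close>, so
    the ear property puts all of \<open>C - L\<close> into the new circuit.\<close>
  have elim: "\<exists>B\<in>?T. B \<subseteq> K \<union> D - {q}"
    if KD: "K \<in> ?T" "q \<in> K" "D \<in> circuits E indep" "D \<subseteq> L" "q \<in> D" for K q D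
  proof -
    have "e \<in> K - D" using KD C by blast
    then obtain B where B: "B \<in> circuits E indep" "B \<subseteq> K \<union> D - {q}" "e \<in> B"
      using strong_circuit_elimination[of K D q e] KD by blast
    then have "B \<subseteq> L \<union> C" using KD by blast
    then have "B \<in> ?T" using ear[rule_format, OF B(1)] B C(3) by blast
    then show ?thesis using B by blast
  qed
  obtain p where p: "p \<in> C" "p \<in> L" using C by blast
  obtain D D' where D: "D \<in> circuits E indep" "D' \<in> circuits E indep" "D \<noteq> D'" "p \<in> D" "p \<in> D'"
      "D \<subseteq> L" "D' \<subseteq> L"
    using two[OF p(2)] by blast
  have CT: "C \<in> ?T" using C by blast
  obtain B where B: "B \<in> ?T" "B \<subseteq> C \<union> D - {p}" using elim[OF CT p(1) D(1,6,4)] by blast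
  have BC: "B \<noteq> C" using B p by blast
  have "\<exists>B'\<in>?T. B' \<noteq> B \<and> B' \<noteq> C"
  proof (rule ccontr)
    assume "\<not> ?thesis"
    then have T: "B' = B \<or> B' = C" if "B' \<in> ?T" for B' using that by blast
    \<comment> \<open>The circuit left after eliminating \<open>q\<close> from \<open>C\<close>
      avoids \<open>q\<close>, so it is not \<open>C\<close> and must be \<open>B\<close>. The next
      fact exchanges the two roles.\<close>
    have CX: "B \<subseteq> C \<union> X" if "X \<in> circuits E indep" "X \<subseteq> L" "q \<in> X" "q \<in> C" for X q
      using elim[OF CT that(4,1-3)] T that(4) by blast
    have BX: "C \<subseteq> B \<union> X" if "X \<in> circuits E indep" "X \<subseteq> L" "q \<in> X" "q \<in> B" for X q
      using elim[OF B(1) that(4,1-3)] T that(4) by blast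
    \<comment> \<open>Eliminating a common point in \<open>L\<close> from \<open>C\<close> would
      give a circuit of \<open>?T\<close> that is neither \<open>B\<close> nor
      \<open>C\<close>.\<close>
    have disj: "B \<inter> C \<inter> L = {}"
    proof (rule ccontr)
      assume "B \<inter> C \<inter> L \<noteq> {}"
      then obtain q where q: "q \<in> B" "q \<in> C" "q \<in> L" by blast
      obtain X where "X \<in> circuits E indep" "X \<subseteq> L" "q \<in> X" using two[OF q(3)] by blast
      then show False using elim[OF CT q(2)] T q by blast
    qed
    have "\<not> B \<subseteq> C" using circuit_subset_eq B(1) C(1) BC by blast
    then obtain q where q: "q \<in> B" "q \<notin> C" by blast
    obtain X where X: "X \<in> circuits E indep" "X \<subseteq> B \<union> C - {e}"
      using circuit_elimination[of B C e] B(1) C BC by blast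
    then have XL: "X \<subseteq> L" using ear[rule_format, OF X(1)] B(1) C by blast
    \<comment> \<open>A point of \<open>X\<close> lies in exactly one of \<open>B\<close> and
      \<open>C\<close>, so \<open>CX\<close> or \<open>BX\<close> forces it into \<open>Y\<close>.
      Taking \<open>D\<close> and \<open>D'\<close> for \<open>Y\<close> then makes both equal to
      \<open>X\<close>.\<close>
    have sup: "X \<subseteq> Y" if Y: "Y \<in> circuits E indep" "Y \<subseteq> L" "p \<in> Y" for Y
    proof -
      have BY: "B \<subseteq> C \<union> Y" using CX[OF Y p(1)] .
      then have "q \<in> Y" using q by blast
      then have "C \<subseteq> B \<union> Y" using BX[OF Y(1,2) _ q(1)] by blast
      then show ?thesis using BY X(2) XL disj by blast
    qed
    have "X = D" "X = D'"
      using circuit_subset_eq[OF X(1) D(1) sup[OF D(1,6,4)]]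
        circuit_subset_eq[OF X(1) D(2) sup[OF D(2,7,5)]] .
    then show False using D by simp
  qed
  then obtain B' where B': "B' \<in> ?T" "B' \<noteq> B" "B' \<noteq> C" by blast
  show ?thesis
  proof (rule that[of B C B'])
    show "{B, C, B'} \<subseteq> circuits E indep" using B(1) CT B'(1) by blast
    show "distinct [B, C, B']" using BC B' by auto
    show "\<forall>X\<in>{B, C, B'}. X \<subseteq> L \<union> C \<and> C - L \<subseteq> X" using B(1) CT B'(1) by simp
  qed
qed

end

section \<open>Sums of circuits in the target, and the homomorphism theorem\<close>

text \<open>By minimality, each circuit is itself a cycle of the representing matrix; the sum of two
  distinct ones is a nonempty cycle.\<close>

lemma binary_sym_diff_dependent:
  assumes "matroid E indep" "binary_matroid E indep"
    and C: "C1 \<in> circuits E indep" "C2 \<in> circuits E indep" "C1 \<noteq> C2"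
  shows "\<not> indep ((C1 - C2) \<union> (C2 - C1))"
proof -
  interpret matroid E indep by fact
  obtain r A where A: "\<And>X. X \<subseteq> E \<Longrightarrow> indep X \<longleftrightarrow> columns_indep r A X"
    using assms(2) unfolding binary_matroid_def by blast
  have indep_iff: "indep X \<longleftrightarrow> (\<forall>Z\<subseteq>X. Z \<noteq> {} \<longrightarrow> \<not> binary_cycle r A Z)" if "X \<subseteq> E" for X
    using A[OF that] columns_indep_iff_no_binary_cycle finite_subset[OF that finite_ground] by metis
  have cyc: "binary_cycle r A C" if D: "C \<in> circuits E indep" for C
  proof -
    have "\<not> indep C" "C \<subseteq> E" using D by (auto simp: circuits_def)
    then obtain Z where Z: "Z \<subseteq> C" "Z \<noteq> {}" "binary_cycle r A Z" using indep_iff by blast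
    then have "\<not> indep Z" using indep_iff[of Z] \<open>C \<subseteq> E\<close> by blast
    then have "Z = C" using Z D by (auto simp: circuits_def)
    then show ?thesis using Z by simp
  qed
  let ?W = "(C1 - C2) \<union> (C2 - C1)"
  have "?W \<subseteq> E" using C circuit_subset_ground by blast
  moreover have "binary_cycle r A ?W"
    using C by (intro binary_cycle_sym_diff circuit_finite cyc)
  moreover have "?W \<noteq> {}" using C by blast
  ultimately show ?thesis using indep_iff by blast
qed

theorem theorem4:
  fixes EM :: "'a set" and indepM :: "'a set \<Rightarrow> bool"
    and EN :: "'b set" and indepN :: "'b set \<Rightarrow> bool"
    and f :: "'a \<Rightarrow> 'b"
  assumes "matroid EM indepM" and "connected_matroid EM indepM"
    and "matroid EN indepN" and "binary_matroid EN indepN"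
    and "EN \<notin> circuits EN indepN"
    and "matroid_hom f EM indepM EN indepN"
  shows "binary_matroid EM indepM"
proof (rule ccontr)
  assume nb: "\<not> binary_matroid EM indepM"
  interpret M: matroid EM indepM by fact
  interpret N: matroid EN indepN by fact
  let ?CM = "circuits EM indepM" and ?CN = "circuits EN indepN"
  have onto: "f ` EM = EN" and hom: "\<And>C. C \<in> ?CM \<Longrightarrow> f ` C \<in> ?CN"
    using assms(6) by (auto simp: matroid_hom_def)
  have sym_diff_eq: "D = (D1 - D2) \<union> (D2 - D1)"
    if "D \<in> ?CN" "D1 \<in> ?CN" "D2 \<in> ?CN" "D1 \<noteq> D2" "(D1 - D2) \<union> (D2 - D1) \<subseteq> D" for D D1 D2
  proof (rule ccontr)
    assume "\<not> ?thesis"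
    then have "(D1 - D2) \<union> (D2 - D1) \<subset> D" using that(5) by blast
    then have "indepN ((D1 - D2) \<union> (D2 - D1))" using that(1) by (simp add: circuits_def)
    then show False using binary_sym_diff_dependent[OF assms(3,4) that(2-4)] by blast
  qed
  obtain C1 C2 C3 C4 L where C: "{C1, C2, C3, C4} \<subseteq> ?CM" and dist: "distinct [C1, C2, C3, C4]"
    and L: "C1 \<union> C2 = L" "C3 \<union> C4 \<subseteq> L"
    and un: "\<forall>C\<in>?CM. \<forall>C'\<in>?CM. C \<subseteq> L \<longrightarrow> C' \<subseteq> L \<longrightarrow> C \<noteq> C' \<longrightarrow> C \<union> C' = L"
    by (rule M.not_binary_four_circuits[OF nb])
  let ?D = "f ` L"
  have LE: "L \<subseteq> EM" "L \<noteq> {}" using L C M.circuit_subset_ground M.circuit_nonempty by auto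
  have unf: "f ` X \<union> f ` Y = ?D" if "X \<in> {C1, C2, C3, C4}" "Y \<in> {C1, C2, C3, C4}" "X \<noteq> Y" for X Y
  proof -
    have "X \<union> Y = L" using un[rule_format, of X Y] that C L by blast
    then show ?thesis by blast
  qed
  have D: "?D \<in> ?CN"
  proof (rule ccontr)
    assume D: "?D \<notin> ?CN"
    have ne: "f ` X \<noteq> ?D" if "X \<in> {C1, C2, C3, C4}" for X
      using D hom C that by (metis subsetD)
    have u: "f ` C1 \<union> f ` C2 = ?D" "f ` C1 \<union> f ` C3 = ?D" "f ` C1 \<union> f ` C4 = ?D"
        "f ` C2 \<union> f ` C3 = ?D" "f ` C2 \<union> f ` C4 = ?D" "f ` C3 \<union> f ` C4 = ?D"
      using unf dist by auto
    have n: "f ` C1 \<noteq> ?D" "f ` C2 \<noteq> ?D" "f ` C4 \<noteq> ?D" using ne by blast+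
    have h: "f ` C1 \<in> ?CN" "f ` C2 \<in> ?CN" "f ` C3 \<in> ?CN" using hom C by auto
    have "f ` C1 \<noteq> f ` C2" using u(1) n(1) by (metis Un_absorb)
    moreover have "(f ` C1 - f ` C2) \<union> (f ` C2 - f ` C1) \<subseteq> f ` C3" using u(1,2,4) by blast
    ultimately have eq: "f ` C3 = (f ` C1 - f ` C2) \<union> (f ` C2 - f ` C1)"
      using sym_diff_eq[OF h(3,1,2)] by blast
    obtain y where y: "y \<in> ?D" "y \<notin> f ` C4" using n(3) u(6) by blast
    then have "y \<in> f ` C1" "y \<in> f ` C2" "y \<in> f ` C3" using u by blast+
    then show False using eq by blast
  qed
  have fC: "f ` X = ?D" if "X \<in> ?CM" "X \<subseteq> L" for X
    using N.circuit_subset_eq[OF hom[OF that(1)] D] that by blast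
  have two: "\<exists>D\<in>?CM. \<exists>D'\<in>?CM. D \<noteq> D' \<and> p \<in> D \<and> p \<in> D' \<and> D \<subseteq> L \<and> D' \<subseteq> L"
    if p: "p \<in> L" for p
  proof -
    \<comment> \<open>Any two of three circuits cover \<open>L\<close>, so each point is in at least
      two of them.\<close>
    have u: "C1 \<union> C2 = L" "C1 \<union> C3 = L" "C2 \<union> C3 = L"
      using un[rule_format, of C1 C2] un[rule_format, of C1 C3] un[rule_format, of C2 C3] C L dist by auto
    then have "p \<in> C1 \<and> p \<in> C2 \<or> p \<in> C1 \<and> p \<in> C3 \<or> p \<in> C2 \<and> p \<in> C3" using p by blast
    moreover have "C1 \<noteq> C2" "C1 \<noteq> C3" "C2 \<noteq> C3" "C1 \<in> ?CM" "C2 \<in> ?CM" "C3 \<in> ?CM"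
      using dist C by auto
    ultimately show ?thesis using u by blast
  qed
  have "f e \<in> ?D" if e: "e \<in> EM" for e
  proof (rule ccontr)
    assume fe: "f e \<notin> ?D"
    then have eL: "e \<in> EM - L" using e by blast
    obtain C where C: "C \<in> ?CM" "e \<in> C" "C \<inter> L \<noteq> {}"
      and ear: "\<forall>D\<in>?CM. D \<subseteq> L \<union> C \<longrightarrow> D \<subseteq> L \<or> C - L \<subseteq> D"
      by (rule M.connected_ear[OF assms(2) LE eL])
    have enL: "e \<notin> L" using eL by blast
    obtain B1 B2 B3 where B: "{B1, B2, B3} \<subseteq> ?CM" "distinct [B1, B2, B3]"
      and Bsub: "\<forall>B\<in>{B1, B2, B3}. B \<subseteq> L \<union> C \<and> C - L \<subseteq> B"
      by (rule M.three_circuits_through_ear[OF C(1,2) enL C(3) ear two])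
    have cover: "?D \<subseteq> f ` X \<union> f ` Y"
      if XY: "X \<in> {B1, B2, B3}" "Y \<in> {B1, B2, B3}" "X \<noteq> Y" for X Y
    proof -
      have XYC: "X \<in> ?CM" "Y \<in> ?CM" using B XY by blast+
      have "e \<in> X \<inter> Y" using bspec[OF Bsub XY(1)] bspec[OF Bsub XY(2)] C eL by blast
      \<comment> \<open>\<open>Z\<close> avoids \<open>e\<close>, so it cannot contain the ear and
        lies inside \<open>L\<close>; hence its image is all of \<open>?D\<close>.\<close>
      then obtain Z where Z: "Z \<in> ?CM" "Z \<subseteq> X \<union> Y - {e}"
        using M.circuit_elimination[OF XYC XY(3)] by blast
      moreover have "Z \<subseteq> L \<union> C" using Z bspec[OF Bsub XY(1)] bspec[OF Bsub XY(2)] by blast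
      ultimately have "Z \<subseteq> L" using ear[rule_format, OF Z(1)] C eL by blast
      then have "f ` Z = ?D" using fC Z by blast
      then show ?thesis using Z(2) by blast
    qed
    have nsub: "\<not> ?D \<subseteq> f ` X" if X: "X \<in> {B1, B2, B3}" for X
    proof
      assume "?D \<subseteq> f ` X"
      then have "?D = f ` X" using N.circuit_subset_eq[OF D hom[OF subsetD[OF B(1) X]]] by blast
      moreover have "e \<in> X" using bspec[OF Bsub X] C eL by blast
      ultimately show False using fe by blast
    qed
    \<comment> \<open>Outside \<open>L\<close> the circuits through the ear agree, so their images
      can differ only inside \<open>?D\<close>.\<close>
    have img: "f ` X \<subseteq> ?D \<union> f ` Y" if "X \<in> {B1, B2, B3}" "Y \<in> {B1, B2, B3}" for X Y
      using bspec[OF Bsub that(1)] bspec[OF Bsub that(2)] by blast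
    have c: "?D \<subseteq> f ` B1 \<union> f ` B2" "?D \<subseteq> f ` B1 \<union> f ` B3" "?D \<subseteq> f ` B2 \<union> f ` B3"
      using cover B(2) by auto
    have n: "\<not> ?D \<subseteq> f ` B1" "\<not> ?D \<subseteq> f ` B3" using nsub by blast+
    have i: "f ` B1 \<subseteq> ?D \<union> f ` B2" "f ` B2 \<subseteq> ?D \<union> f ` B1" using img by blast+
    have h: "f ` B1 \<in> ?CN" "f ` B2 \<in> ?CN" using hom B by auto
    have "f ` B1 \<noteq> f ` B2" using c(1) n(1) by (metis Un_absorb)
    moreover have "(f ` B1 - f ` B2) \<union> (f ` B2 - f ` B1) \<subseteq> ?D"
      using i by (simp add: Diff_subset_conv Un_commute)
    ultimately have eq: "?D = (f ` B1 - f ` B2) \<union> (f ` B2 - f ` B1)"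
      using sym_diff_eq[OF D h] by blast
    obtain y where "y \<in> ?D" "y \<notin> f ` B3" using n(2) by blast
    then have "y \<in> f ` B1" "y \<in> f ` B2" "y \<in> ?D" using c by blast+
    then show False using eq by blast
  qed
  then have "EN = ?D" using onto LE by blast
  then show False using D assms(5) by simp
qed

end
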